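(* Let $\alpha$ be irrational with regular continued fraction expansion $\alpha=[a_0;a_1,a_2,\dots]$, and suppose $R:=\liminf_{i\to\infty}a_i$ satisfies $2\le R<\infty$. With $\gamma_{**}$, $R_*$, $\theta_1$ as in the context, $$M(\alpha,\gamma_{**})\ \ge\ \frac14\left(1-\frac{2}{R_*}\right)\left(1-2\theta_1^2-\theta_1^3\right)\ \ge\ \frac14\left(1-\frac{2}{R_*}-\frac{2}{R_*^2}+\frac{3}{R_*^3}\right).$$
   Context: For real $x$, $\|x\|$ is the distance to the nearest integer. $M(\alpha,\gamma):=\liminf_{|n|\to\infty}|n|\,\|n\alpha-\gamma\|$ ($n\in\mathbb Z$). Regular continued fraction: $a_0=\lfloor\alpha\rfloor$, $a_i\ge1$, $\alpha=a_0+\cfrac{1}{a_1+\cfrac{1}{a_2+\cdots}}$; convergents $p_{-1}=1,q_{-1}=0,p_0=a_0,q_0=1$, $p_i=a_ip_{i-1}+p_{i-2}$, $q_i=a_iq_{i-1}+q_{i-2}$; $D_i:=|q_i\alpha-p_i|$. Let $\lambda_i'=0$ if $a_i$ is even and $\lambda_i'=1$ if $a_i$ is odd, and $\gamma_{**}:=\sum_{i\ge1}\tfrac12(a_i+\lambda_i')D_{i-1}$. $R_*:=R$ if $R$ is odd, $R+1$ if $R$ is even; $\theta_1:=\tfrac12(\sqrt{R_*^2+4}-R_* )$. *)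

theory Defs
  imports "HOL-Analysis.Analysis"
begin

definition dist_nearest_int :: "real \<Rightarrow> real" where
  "dist_nearest_int x = \<bar>x - of_int (round x)\<bar>"

text \<open>The filter \<open>filtercomap abs at_top\<close> on the integers expresses \<open>\<bar>n\<bar> \<rightarrow> \<infinity>\<close>,
  so positive and negative \<open>n\<close> are both taken into account.\<close>

definition inhom_const :: "real \<Rightarrow> real \<Rightarrow> ereal" where
  "inhom_const \<alpha> \<gamma> =
     Liminf (filtercomap (\<lambda>n::int. \<bar>n\<bar>) at_top)
       (\<lambda>n. ereal (of_int \<bar>n\<bar> * dist_nearest_int (of_int n * \<alpha> - \<gamma>)))"

text \<open>\<open>cf_trunc a n\<close> is the value of the finite continued fraction \<open>[a 0; a 1, \<dots>, a n]\<close>.\<close>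

primrec cf_trunc :: "(nat \<Rightarrow> int) \<Rightarrow> nat \<Rightarrow> real" where
  "cf_trunc a 0 = of_int (a 0)"
| "cf_trunc a (Suc n) = of_int (a 0) + 1 / cf_trunc (\<lambda>i. a (Suc i)) n"

definition regular_cf_expansion :: "(nat \<Rightarrow> int) \<Rightarrow> real \<Rightarrow> bool" where
  "regular_cf_expansion a \<alpha> \<longleftrightarrow>
     a 0 = \<lfloor>\<alpha>\<rfloor> \<and> (\<forall>i\<ge>1. a i \<ge> 1) \<and> cf_trunc a \<longlonglongrightarrow> \<alpha>"

text \<open>The equations at index \<open>1\<close> are the general recurrence with
  \<open>p\<close>, \<open>q\<close> at index \<open>-1\<close> equal to \<open>1\<close> and \<open>0\<close>, respectively.\<close>

fun cf_p :: "(nat \<Rightarrow> int) \<Rightarrow> nat \<Rightarrow> int" where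
  "cf_p a 0 = a 0"
| "cf_p a (Suc 0) = a 1 * a 0 + 1"
| "cf_p a (Suc (Suc i)) = a (Suc (Suc i)) * cf_p a (Suc i) + cf_p a i"

fun cf_q :: "(nat \<Rightarrow> int) \<Rightarrow> nat \<Rightarrow> int" where
  "cf_q a 0 = 1"
| "cf_q a (Suc 0) = a 1 * 1 + 0"
| "cf_q a (Suc (Suc i)) = a (Suc (Suc i)) * cf_q a (Suc i) + cf_q a i"

definition cf_D :: "(nat \<Rightarrow> int) \<Rightarrow> real \<Rightarrow> nat \<Rightarrow> real" where
  "cf_D a \<alpha> i = \<bar>of_int (cf_q a i) * \<alpha> - of_int (cf_p a i)\<bar>"

definition parity_corr :: "(nat \<Rightarrow> int) \<Rightarrow> nat \<Rightarrow> int" where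
  "parity_corr a i = (if even (a i) then 0 else 1)"

text \<open>The sum over \<open>i \<ge> 1\<close> is reindexed by \<open>i = Suc j\<close>.\<close>

definition gamma_ss :: "(nat \<Rightarrow> int) \<Rightarrow> real \<Rightarrow> real" where
  "gamma_ss a \<alpha> =
     (\<Sum>j. 1/2 * of_int (a (Suc j) + parity_corr a (Suc j)) * cf_D a \<alpha> j)"

definition R_star :: "int \<Rightarrow> int" where
  "R_star R = (if odd R then R else R + 1)"

definition theta1 :: "int \<Rightarrow> real" where
  "theta1 R = 1/2 * (sqrt (of_int (R_star R) ^ 2 + 4) - of_int (R_star R))"

end

theory Submission
  imports Defs
begin

text \<open>
  The points \<open>(n, n\<alpha> - m - \<gamma>\<^sub>*\<^sub>*)\<close> form a translate of a planar lattice, of which consecutive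
  convergents are a basis. Since \<open>\<Sum> a\<^sub>i D\<^sub>i\<^sub>-\<^sub>1 = 1 + D\<^sub>0\<close> telescopes, twice a point is a
  combination of two consecutive convergents with odd coefficients \<open>(A, B)\<close>, up to corrections
  \<open>\<sigma>\<close> and \<open>\<tau>\<close> that only involve the \<open>\<lambda>'\<^sub>i\<close>. The points with \<open>A, B \<in> {1, -1}\<close> are the vertices of
  a cell, one in each quadrant. For large \<open>\<bar>n\<bar>\<close>, either the second coordinate is bounded away from
  \<open>0\<close>, or the sign of \<open>A B\<close> changes from positive to negative between two consecutive cells. At that
  change \<open>\<bar>n\<bar> \<bar>n\<alpha> - m - \<gamma>\<^sub>*\<^sub>*\<bar>\<close> is a concave function of \<open>A\<close>, hence at least its value at a vertex
  of one of the two cells.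

  Odd partial quotients are eventually at least \<open>r = R\<^sub>*\<close>, even ones at least \<open>r - 1\<close>.
  Put \<open>\<phi> = q\<^sub>k\<^sub>-\<^sub>1 / q\<^sub>k\<close>, \<open>\<psi> = D\<^sub>k / D\<^sub>k\<^sub>-\<^sub>1\<close>, \<open>s = \<sigma>\<^sub>k / q\<^sub>k\<close>, \<open>T = \<tau>\<^sub>k / D\<^sub>k\<^sub>-\<^sub>1\<close>.
  The extremal tail is the one with all partial quotients equal to \<open>r\<close>, and the vertex \<open>(1 - \<phi> - s) (1 + \<psi> - T)\<close> gives the constant.
\<close>

section \<open>The four vertex inequalities\<close>

text \<open>\<open>x\<close> is a partial quotient and \<open>l\<close> its parity correction \<open>\<lambda>'\<close>.\<close>

definition cf_digit :: "real \<Rightarrow> real \<Rightarrow> real \<Rightarrow> bool" where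
  "cf_digit r x l \<longleftrightarrow> (l = 1 \<and> r \<le> x) \<or> (l = 0 \<and> r - 1 \<le> x)"

text \<open>The equation for \<theta> forces \<open>\<theta> \<le> 1 / r\<close>. Replacing \<theta>
  by \<open>1 / r\<close> decreases the product, and expanding it then leaves the other side plus
  \<open>2 / r^4\<close>. This is the second inequality of the theorem up to the factor 1/4.\<close>

lemma vertex_const_le:
  fixes r \<theta> :: real
  assumes r: "3 \<le> r" and th: "0 < \<theta>" "\<theta> * (r + \<theta>) = 1"
  shows "(1 - 2 / r) * (1 - 2 * \<theta>^2 - \<theta>^3) \<ge> 1 - 2 / r - 2 / r^2 + 3 / r^3"
proof -
  have "\<theta> * r \<le> 1" using th(2) mult_pos_pos[OF th(1) th(1)] unfolding distrib_left by linarith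
  then have le: "\<theta> \<le> 1 / r" using r by (simp add: field_simps)
  have "\<theta>^2 \<le> (1/r)^2" "\<theta>^3 \<le> (1/r)^3"
    using le th by (auto intro!: power_mono)
  then have "1 - 2 * \<theta>^2 - \<theta>^3 \<ge> 1 - 2 * (1/r)^2 - (1/r)^3" by linarith
  then have "(1 - 2 / r) * (1 - 2 * \<theta>^2 - \<theta>^3) \<ge> (1 - 2 / r) * (1 - 2 * (1/r)^2 - (1/r)^3)"
    using r by (intro mult_left_mono) (auto simp: field_simps)
  moreover have "(1 - 2 * u) * (1 - 2 * u^2 - u^3) = 1 - 2 * u - 2 * u^2 + 3 * u^3 + 2 * u^4"
    for u :: real
    by (simp add: algebra_simps power2_eq_square power3_eq_cube power4_eq_xxxx)
  from this[of "1/r"] have "(1 - 2 / r) * (1 - 2 * (1/r)^2 - (1/r)^3)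
      = 1 - 2 * (1/r) - 2 * (1/r)^2 + 3 * (1/r)^3 + 2 * (1/r)^4" by simp
  moreover have "0 \<le> (1/r)^4" using r by (intro zero_le_power) auto
  ultimately have "1 - 2 * (1/r) - 2 * (1/r)^2 + 3 * (1/r)^3 \<le> (1 - 2 / r) * (1 - 2 * \<theta>^2 - \<theta>^3)"
    by linarith
  then show ?thesis by (simp add: power_divide)
qed

text \<open>The equation makes \<theta> the periodic continued fraction [0; r, r, ...]. Its tail
  \<open>t\<close> is the fixed point of T = \<theta> (1 + T), and \<open>c\<close> is four times
  the asserted lower bound.\<close>

locale vertex_bounds =
  fixes r \<theta> t c :: real
  assumes r3: "3 \<le> r" and th_pos: "0 < \<theta>" and th_eq: "\<theta> * (r + \<theta>) = 1"
    and t_def: "t = \<theta> / (1 - \<theta>)"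
    and c_def: "c = (1 - 2 / r) * (1 - 2 * \<theta>^2 - \<theta>^3)"
begin

section \<open>Estimates for the extremal values and for tails\<close>

lemma th_third: "\<theta> < 1/3"
proof (rule ccontr)
  assume "\<not> \<theta> < 1/3"
  then have "1/3 * 3 \<le> \<theta> * r" using r3 by (intro mult_mono) auto
  then show False using th_eq mult_pos_pos[OF th_pos th_pos] by (simp add: distrib_left)
qed

lemma t_eq: "t * (1 - \<theta>) = \<theta>" "t = \<theta> * (1 + t)" "t * (r + \<theta>) = 1 + t"
proof -
  show 1: "t * (1 - \<theta>) = \<theta>" using th_third by (simp add: t_def)
  then show 2: "t = \<theta> * (1 + t)" by (simp add: algebra_simps)
  show "t * (r + \<theta>) = 1 + t" using 2 th_eq by (metis mult.assoc mult.commute mult.right_neutral)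
qed

lemma t_bounds: "0 < t" "t < 1/2"
  using th_third th_pos by (auto simp: t_def field_simps)

lemma c_factor: "1 - 2 * \<theta>^2 - \<theta>^3 = (1 - \<theta> - \<theta>^2) * (1 + \<theta>)"
  by (simp add: algebra_simps power2_eq_square power3_eq_cube)

lemma th_sq: "\<theta>^2 \<le> 1 - 3 * \<theta>"
proof -
  have "\<theta> * 3 \<le> \<theta> * r" using r3 th_pos by simp
  then show ?thesis using th_eq by (simp add: algebra_simps power2_eq_square)
qed

lemma cube_factor: "0 < 1 - 2 * \<theta>^2 - \<theta>^3" "1 - 2 * \<theta>^2 - \<theta>^3 \<le> 1"
proof -
  have "0 < 1 - \<theta> - \<theta>^2" using th_sq th_pos by linarith
  then show "0 < 1 - 2 * \<theta>^2 - \<theta>^3" unfolding c_factor using th_pos by simp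
  show "1 - 2 * \<theta>^2 - \<theta>^3 \<le> 1" using th_pos zero_le_power[of \<theta> 2] zero_le_power[of \<theta> 3] by linarith
qed

lemma c_pos: "0 < c"
  unfolding c_def using cube_factor r3 by (intro mult_pos_pos) (auto simp: field_simps)

lemma c_le: "c \<le> 1 - 2 / r"
proof -
  have "0 \<le> 1 - 2 / r" using r3 by (simp add: field_simps)
  then show ?thesis unfolding c_def using cube_factor(2) by (metis mult.right_neutral mult_left_mono)
qed

text \<open>Since \<open>1 / r = \<theta> / (1 - \<theta>^2)\<close>, a factor
  \<open>1 + \<theta>\<close> cancels, and after multiplication by \<open>1 - \<theta>\<close> both
  sides are polynomials in \<theta>. This settles the vertex with second factor
  \<open>1 - \<psi> - T\<close>.\<close>

lemma c_le_tail: "c \<le> 1 - \<theta> - t"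
proof -
  have req: "r * \<theta> = 1 - \<theta>^2" using th_eq by (simp add: algebra_simps power2_eq_square)
  have p: "0 < 1 - \<theta>^2" "0 < 1 - \<theta>" "0 < 1 + \<theta>" using th_third th_pos th_sq by auto
  have r1: "2 / r = 2 * \<theta> / (1 - \<theta>^2)" using req r3 th_pos p by (simp add: field_simps)
  have fac: "1 - \<theta>^2 = (1 - \<theta>) * (1 + \<theta>)" by (simp add: algebra_simps power2_eq_square)
  have "c * (1 - \<theta>^2) = (1 - \<theta>^2 - 2 * \<theta>) * ((1 - \<theta> - \<theta>^2) * (1 + \<theta>))"
    unfolding c_def c_factor r1 using p by (simp add: field_simps)
  then have "(c * (1 - \<theta>)) * (1 + \<theta>) = ((1 - \<theta>^2 - 2 * \<theta>) * (1 - \<theta> - \<theta>^2)) * (1 + \<theta>)"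
    unfolding fac by (simp add: mult.assoc)
  then have "c * (1 - \<theta>) = (1 - \<theta>^2 - 2 * \<theta>) * (1 - \<theta> - \<theta>^2)" using p by simp
  also have "\<dots> = 1 - 3 * \<theta> + \<theta>^2 - \<theta>^2 * (1 - 3 * \<theta> - \<theta>^2)"
    by (simp add: algebra_simps power2_eq_square)
  also have "\<dots> \<le> 1 - 3 * \<theta> + \<theta>^2" using th_sq by simp
  also have "\<dots> = (1 - \<theta> - t) * (1 - \<theta>)"
    using t_eq(1) by (simp add: algebra_simps power2_eq_square)
  finally show ?thesis using p by simp
qed

text \<open>A tail \<open>T = \<psi> (\<lambda> + T')\<close> with \<open>\<psi> = 1/(x + \<psi>')\<close> is largest when all partial quotients
  equal \<open>r\<close>, where \<open>\<psi> = \<theta>\<close> and \<open>T = t\<close>.\<close>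

lemma tail_slope:
  assumes "0 \<le> \<psi>'" "T' \<le> t" "T' \<le> \<psi>' * (1 + t)" "0 \<le> m" "m \<le> 1 + t"
  shows "T' - t \<le> m * (\<psi>' - \<theta>)"
\<comment> \<open>The two upper bounds for T' cross at \<psi>' = \<theta>, where both equal
  \<open>t\<close>. A line through this corner with slope between 0 and \<open>1 + t\<close> lies
  above their minimum.\<close>
proof (cases "\<psi>' \<ge> \<theta>")
  case True
  then have "0 \<le> m * (\<psi>' - \<theta>)" using assms by simp
  then show ?thesis using assms by linarith
next
  case False
  have "T' - t \<le> (1 + t) * (\<psi>' - \<theta>)" using assms(3) t_eq(2) by (simp add: algebra_simps)
  also have "\<dots> \<le> m * (\<psi>' - \<theta>)" using False assms by (intro mult_right_mono_neg) auto
  finally show ?thesis .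
qed

text \<open>For an odd partial quotient the slope \<open>t\<close> in \<open>tail_slope\<close>
  fits, because \<open>t * (r + \<theta>) = 1 + t\<close>; an even one merely divides T' by at least
  2.\<close>

lemma tail_step:
  assumes d: "cf_digit r x l" and p: "0 \<le> \<psi>'" "0 \<le> T'" "T' \<le> t" "T' \<le> \<psi>' * (1 + t)"
  shows "(l + T') / (x + \<psi>') \<le> t"
proof -
  have x: "0 < x + \<psi>'" using d r3 p(1) unfolding cf_digit_def by linarith
  have "l + T' \<le> t * (x + \<psi>')"
    using d unfolding cf_digit_def
  proof (elim disjE conjE)
    assume l: "l = 1" "r \<le> x"
    have "T' - t \<le> t * (\<psi>' - \<theta>)" using t_bounds p by (intro tail_slope) auto
    then have "1 + T' \<le> t * (r + \<psi>')" using t_eq(3) by (simp add: algebra_simps)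
    also have "\<dots> \<le> t * (x + \<psi>')" using l t_bounds by simp
    finally show ?thesis using l by simp
  next
    assume l: "l = 0" "r - 1 \<le> x"
    have "t * 1 \<le> t * (x + \<psi>')" using l t_bounds p r3 by (intro mult_left_mono) auto
    then show ?thesis using l p by simp
  qed
  then show ?thesis using x by (simp add: pos_divide_le_eq)
qed

lemma tail_step_plus:
  assumes d: "cf_digit r x l" and p: "0 \<le> \<psi>'" "0 \<le> T'" "T' \<le> t" "T' \<le> \<psi>' * (1 + t)"
  shows "(1 + l + T') / (x + \<psi>') \<le> \<theta> + t"
proof -
  have x: "0 < x + \<psi>'" using d r3 p(1) unfolding cf_digit_def by linarith
  have eq: "(\<theta> + t) * (r + \<theta>) = 2 + t" unfolding distrib_right[of \<theta> t] t_eq(3) th_eq by simp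
  have "1 + l + T' \<le> (\<theta> + t) * (x + \<psi>')"
    using d unfolding cf_digit_def
  proof (elim disjE conjE)
    assume l: "l = 1" "r \<le> x"
    have "T' - t \<le> (\<theta> + t) * (\<psi>' - \<theta>)" using t_bounds p th_pos th_third by (intro tail_slope) auto
    then have "2 + T' \<le> (\<theta> + t) * (r + \<theta>) + (\<theta> + t) * (\<psi>' - \<theta>)" using eq by linarith
    also have "\<dots> = (\<theta> + t) * (r + \<psi>')" by (simp add: algebra_simps)
    finally have "2 + T' \<le> (\<theta> + t) * (r + \<psi>')" .
    also have "\<dots> \<le> (\<theta> + t) * (x + \<psi>')" using l t_bounds th_pos by (intro mult_left_mono) auto
    finally show ?thesis using l by simp
  next
    assume l: "l = 0" "r - 1 \<le> x"
    \<comment> \<open>Compared with the extremal odd case, the numerator drops by 1, while the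
      denominator may drop from \<open>r + \<theta>\<close> to \<open>r - 1\<close>. This estimate
      says that the first effect outweighs the second.\<close>
    have *: "\<theta> + t + \<theta> * (\<theta> + t) \<le> 1"
    proof -
      have "(1 - \<theta>) * (\<theta> + t + \<theta> * (\<theta> + t)) = (1 + \<theta>) * (\<theta> * (1 - \<theta>) + t * (1 - \<theta>))"
        by (simp add: algebra_simps)
      also have "\<dots> = 2 * \<theta> + \<theta>^2 - \<theta>^3"
        unfolding t_eq(1) by (simp add: algebra_simps power2_eq_square power3_eq_cube)
      also have "\<dots> \<le> 1 - \<theta>" using th_sq zero_less_power[OF th_pos, of 3] by linarith
      finally have "(1 - \<theta>) * (\<theta> + t + \<theta> * (\<theta> + t)) \<le> (1 - \<theta>) * 1" by simp
      then show ?thesis by (rule mult_left_le_imp_le) (use th_third in simp)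
    qed
    have "1 + T' \<le> (\<theta> + t) * (r + \<theta>) - (\<theta> + t + \<theta> * (\<theta> + t))" using eq * p(3) by linarith
    also have "\<dots> = (\<theta> + t) * (r - 1)" by (simp add: algebra_simps)
    finally have "1 + T' \<le> (\<theta> + t) * (r - 1)" .
    also have "\<dots> \<le> (\<theta> + t) * (x + \<psi>')" using l t_bounds th_pos p by (intro mult_left_mono) auto
    finally show ?thesis using l by simp
  qed
  then show ?thesis using x by (simp add: pos_divide_le_eq)
qed

text \<open>With \<open>C\<close> for the cubic factor, this is
  \<open>C * (1 + \<theta> / r) = 1 - \<theta> * t\<close> multiplied by
  \<open>r + \<theta> = 1 / \<theta>\<close>. It is the equality case that produces the cubic factor
  of \<open>c\<close>.\<close>

lemma tail_const: "(1 - (1 - 2 * \<theta>^2 - \<theta>^3)) * (r + \<theta>) = t + (1 - 2 * \<theta>^2 - \<theta>^3) * (1 / r)"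
proof -
  have r_eq: "r * \<theta> = 1 - \<theta>^2" "r + \<theta> = 1 / \<theta>"
    using th_eq th_pos by (simp_all add: field_simps power2_eq_square)
  have p: "0 < 1 - \<theta>^2" "0 < 1 - \<theta>" "0 < 1 + \<theta>" using th_third th_pos th_sq by auto
  have 1: "1 / r = \<theta> / (1 - \<theta>^2)" using r_eq r3 th_pos p by (simp add: field_simps)
  have 2: "1 - \<theta>^2 = (1 - \<theta>) * (1 + \<theta>)" by (simp add: algebra_simps power2_eq_square)
  have "(1 - 2 * \<theta>^2 - \<theta>^3) * (1 / r) = (1 - \<theta> - \<theta>^2) * \<theta> / (1 - \<theta>)"
    unfolding c_factor 1 2 using p by simp
  also have "t + \<dots> = (\<theta> + (1 - \<theta> - \<theta>^2) * \<theta>) / (1 - \<theta>)"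
    by (simp add: t_def add_divide_distrib)
  also have "\<theta> + (1 - \<theta> - \<theta>^2) * \<theta> = (2 * \<theta> + \<theta>^2) * (1 - \<theta>)"
    by (simp add: algebra_simps power2_eq_square)
  also have "\<dots> / (1 - \<theta>) = 2 * \<theta> + \<theta>^2" using p by simp
  also have "\<dots> = (2 * \<theta>^2 + \<theta>^3) / \<theta>" using th_pos by (simp add: field_simps power2_eq_square power3_eq_cube)
  finally show ?thesis unfolding r_eq(2) by simp
qed

section \<open>Normalised vertices of a single cell\<close>

lemma gap_eq: "(1 - 1 / (r - 1)) * (1 - 1 / r) = 1 - 2 / r"
  using r3 by (simp add: field_simps)

lemma gap_bounds: "1 - 2 / r \<le> 1 - 1 / (r - 1)" "0 < 1 - 1 / (r - 1)" "0 < 1 - 2 / r"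
  using r3 by (auto simp: field_simps)

lemma digit_inverse:
  assumes "cf_digit r x l" "0 \<le> p"
  shows "0 < 1 / (x + p)" "1 / (x + p) \<le> 1 / (r - 1)" "1 / (x + p) \<le> 1 / 2"
    "l = 1 \<Longrightarrow> 1 / (x + p) \<le> 1 / r"
  using assms r3 by (auto simp: cf_digit_def intro!: divide_left_mono)

text \<open>Primed variables belong to the neighbouring indices: \<phi>' and s' precede the digit x,
  \<psi>' and T' follow the digit z. The bounds on s' are those that the recursion for s eventually
  enforces.\<close>

context
  fixes x l \<phi>' s' z m \<psi>' T' \<phi> s \<psi> T :: real
  assumes left: "cf_digit r x l" "0 \<le> \<phi>'" "\<phi>' \<le> 1/2" "- \<phi>' / (r - 1) \<le> s'" "s' \<le> 1/2" "s' \<le> 5/4 * \<phi>'"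
    and right: "cf_digit r z m" "0 \<le> \<psi>'" "0 \<le> T'" "T' \<le> t" "T' \<le> \<psi>' * (1 + t)"
    and norm: "\<phi> = 1 / (x + \<phi>')" "s = \<phi> * (l - s')" "\<psi> = 1 / (z + \<psi>')" "T = \<psi> * (m + T')"
begin

lemma s'_ge: "- \<phi>'/2 \<le> s'"
proof -
  have "\<phi>' / (r - 1) \<le> \<phi>' / 2" using r3 left(2) by (intro divide_left_mono) auto
  then show ?thesis using left(4) by linarith
qed

lemma phi_bounds: "0 < \<phi>" "\<phi> \<le> 1 / (r - 1)" "\<phi> \<le> 1/2" "l = 1 \<Longrightarrow> \<phi> \<le> 1 / r"
  using digit_inverse[OF left(1,2)] by (auto simp: norm)

lemma psi_bounds: "0 < \<psi>" "\<psi> \<le> 1 / (r - 1)" "\<psi> \<le> 1/2" "m = 1 \<Longrightarrow> \<psi> \<le> 1 / r"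
  using digit_inverse[OF right(1,2)] by (auto simp: norm)

lemma parity_values: "l = 0 \<or> l = 1" "m = 0 \<or> m = 1" "0 \<le> l" "0 \<le> m"
  using left(1) right(1) by (auto simp: cf_digit_def)

lemma T_nonneg: "0 \<le> T" using psi_bounds(1) parity_values(4) right(3) by (simp add: norm(4))

lemma c_mult_le: "c * (1 + \<phi> * \<psi>) \<le> (1 - 2 / r) * (1 + \<phi> * \<psi>)"
  using c_le phi_bounds(1) psi_bounds(1) by (intro mult_right_mono) auto

text \<open>By \<open>gap_eq\<close> the factor \<open>1 - 2 / r\<close> of \<open>c\<close> can be
  split between the two factors of a vertex; the cubic factor of \<open>c\<close> is given
  away.\<close>

lemma gap_mult:
  assumes "(1 - 1 / r) * (1 + \<phi> * \<psi>) \<le> w" "1 - 1 / (r - 1) \<le> v"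
  shows "c * (1 + \<phi> * \<psi>) \<le> v * w"
proof -
  have 0: "0 \<le> (1 - 1 / r) * (1 + \<phi> * \<psi>)" using r3 phi_bounds(1) psi_bounds(1) by simp
  then have w: "0 \<le> w" using assms(1) by linarith
  have "c * (1 + \<phi> * \<psi>) \<le> (1 - 1 / (r - 1)) * ((1 - 1 / r) * (1 + \<phi> * \<psi>))"
    using c_mult_le by (simp add: gap_eq flip: mult.assoc)
  also have "\<dots> \<le> v * w" using assms gap_bounds(2) by (intro mult_mono 0) auto
  finally show ?thesis .
qed

lemma gap_mult_le: "(1 - 1 / r) * (1 + \<phi> * \<psi>) \<le> 1 - 1 / r + \<phi> * \<psi>"
proof -
  have "0 \<le> (1 / r) * (\<phi> * \<psi>)" using r3 phi_bounds(1) psi_bounds(1) by simp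
  then show ?thesis by (simp add: algebra_simps)
qed

text \<open>The second factor alone is at least \<open>c\<close>, because \<open>\<psi> + T\<close>
  is largest for the constant tail; the first is at least
  \<open>1 + \<phi> * \<psi>\<close>.\<close>

lemma vertex_plus_minus: "c * (1 + \<phi> * \<psi>) \<le> (1 + \<phi> + s) * (1 - \<psi> - T)"
proof -
  have "\<psi> + T = (1 + m + T') / (z + \<psi>')" by (simp add: norm add_divide_distrib)
  then have 1: "c \<le> 1 - \<psi> - T" using tail_step_plus[OF right] c_le_tail by linarith
  have "\<phi> * \<psi> \<le> \<phi> * (1 + l - s')" using phi_bounds(1) psi_bounds(3) parity_values left by (intro mult_left_mono) auto
  then have 2: "1 + \<phi> * \<psi> \<le> 1 + \<phi> + s" by (simp add: norm(2) algebra_simps)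
  have "c * (1 + \<phi> * \<psi>) \<le> (1 - \<psi> - T) * (1 + \<phi> + s)"
    using 1 2 c_pos phi_bounds(1) psi_bounds(1) by (intro mult_mono) auto
  then show ?thesis by (simp add: mult.commute)
qed

text \<open>Here T only helps, so the second factor loses at most \<open>1 / (r - 1)\<close>, and
  \<open>gap_mult\<close> leaves a loss of \<open>1 / r\<close> for the first.\<close>

lemma vertex_plus_minus': "c * (1 + \<phi> * \<psi>) \<le> (1 + \<phi> - s) * (1 - \<psi> + T)"
proof -
  have g: "1 - 1 / (r - 1) \<le> 1 - \<psi> + T" using psi_bounds(2) T_nonneg by linarith
  have "(1 - 1 / r) * (1 + \<phi> * \<psi>) \<le> 1 + \<phi> - s"
    using parity_values(1)
  proof
    assume l: "l = 0"
    have "\<phi> * \<psi> \<le> \<phi> * (1 + s')" using phi_bounds(1) psi_bounds(3) left s'_ge by (intro mult_left_mono) auto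
    then have "1 + \<phi> * \<psi> \<le> 1 + \<phi> - s" by (simp add: norm(2) l algebra_simps)
    moreover have "1 - 1 / r + \<phi> * \<psi> \<le> 1 + \<phi> * \<psi>" using r3 by simp
    ultimately show ?thesis using gap_mult_le by linarith
  next
    assume l: "l = 1"
    have "\<phi> * (\<psi> - s') \<le> \<phi> * 1" using phi_bounds(1) psi_bounds(3) left s'_ge by (intro mult_left_mono) auto
    then have "\<phi> * \<psi> - \<phi> * s' \<le> 1 / r" using phi_bounds(4)[OF l] by (simp add: algebra_simps)
    moreover have "1 + \<phi> - s = 1 + \<phi> * s'" by (simp add: norm(2) l algebra_simps)
    ultimately show ?thesis using gap_mult_le by linarith
  qed
  from gap_mult[OF this g] show ?thesis by (simp add: mult.commute)
qed

lemma vertex_minus_plus': "c * (1 + \<phi> * \<psi>) \<le> (1 - \<phi> + s) * (1 + \<psi> + T)"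
proof -
  have "1 - 2 / r \<le> 1 - \<phi> + s"
    using parity_values(1)
  proof
    assume l: "l = 0"
    have x: "r - 1 \<le> x" using left(1) l by (auto simp: cf_digit_def)
    \<comment> \<open>With \<open>s' \<le> 5/4 * \<phi>'\<close> and \<phi>' at most 1/2, the claim
      reduces to \<open>5/8 * r - 1 \<le> r - 2\<close>, that is, to r being at least 8/3.\<close>
    have "(5/4 * r - 2) * \<phi>' \<le> (5/4 * r - 2) * (1/2)" using left(3) r3 by (intro mult_left_mono) auto
    also have "\<dots> \<le> r - 2" using r3 by simp
    finally have 1: "r * (1 + 5/4 * \<phi>') \<le> 2 * (r - 1 + \<phi>')" by (simp add: algebra_simps)
    have "r * (1 + s') \<le> r * (1 + 5/4 * \<phi>')" using left(6) r3 by simp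
    also note 1
    also have "2 * (r - 1 + \<phi>') \<le> 2 * (x + \<phi>')" using x by simp
    finally have "r * (1 + s') \<le> 2 * (x + \<phi>')" .
    then have "(1 + s') / (x + \<phi>') \<le> 2 / r" using x r3 left(2) by (simp add: field_simps)
    moreover have "\<phi> - s = (1 + s') / (x + \<phi>')" by (simp add: norm l add_divide_distrib)
    ultimately show ?thesis by linarith
  next
    assume l: "l = 1"
    have "\<phi> * s' \<le> \<phi> * 1" using phi_bounds(1) left(5) by (intro mult_left_mono) auto
    moreover have "1 / r \<le> 2 / r" using r3 by (intro divide_right_mono) auto
    ultimately have "\<phi> * s' \<le> 2 / r" using phi_bounds(4)[OF l] by linarith
    moreover have "1 - \<phi> + s = 1 - \<phi> * s'" by (simp add: norm(2) l algebra_simps)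
    ultimately show ?thesis by linarith
  qed
  moreover have "\<phi> * \<psi> \<le> 1 * \<psi>" using phi_bounds psi_bounds(1) by (intro mult_right_mono) auto
  then have "1 + \<phi> * \<psi> \<le> 1 + \<psi> + T" using T_nonneg by simp
  ultimately have "(1 - 2 / r) * (1 + \<phi> * \<psi>) \<le> (1 - \<phi> + s) * (1 + \<psi> + T)"
    using gap_bounds(3) phi_bounds(1) psi_bounds(1) by (intro mult_mono) auto
  then show ?thesis using c_mult_le by linarith
qed

text \<open>This is the extremal vertex. For l = 0 the first factor loses only
  \<open>1 / (r - 1)\<close> and \<open>gap_mult\<close> applies. For l = 1 it may lose
  \<open>2 / r\<close>, so the second factor has to supply the whole cubic factor of
  \<open>c\<close>.\<close>

lemma vertex_minus_plus: "c * (1 + \<phi> * \<psi>) \<le> (1 - \<phi> - s) * (1 + \<psi> - T)"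
proof -
  have xp: "0 < x + \<phi>'" "0 < z + \<psi>'"
    using left(1,2) right(1,2) r3 unfolding cf_digit_def by linarith+
  have m0: "1 + \<phi> * \<psi> \<le> 1 + \<psi> - T" if m: "m = 0"
  proof -
    have "\<psi> * \<phi> \<le> \<psi> * (1 - T')" using psi_bounds(1) phi_bounds(3) right(4) t_bounds by (intro mult_left_mono) auto
    then show ?thesis by (simp add: norm(4) m algebra_simps)
  qed
  have m1: "1 + \<psi> - T = 1 - \<psi> * T'" if m: "m = 1"
    by (simp add: norm(4) m algebra_simps)
  show ?thesis
    using parity_values(1)
  proof
    assume l: "l = 0"
    have x: "r - 1 \<le> x" using left(1) l by (auto simp: cf_digit_def)
    \<comment> \<open>The denominator contains the same \<phi>' as the lower bound for s', so the
      two cancel exactly.\<close>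
    have "1 - s' \<le> 1 + \<phi>' / (r - 1)" using left(4) by simp
    also have "\<dots> = (r - 1 + \<phi>') / (r - 1)" using r3 by (simp add: add_divide_distrib)
    also have "\<dots> \<le> (x + \<phi>') / (r - 1)" using x r3 by (intro divide_right_mono) auto
    finally have "(1 - s') / (x + \<phi>') \<le> 1 / (r - 1)"
      using xp r3 by (simp add: pos_divide_le_eq mult.commute)
    moreover have "\<phi> + s = (1 - s') / (x + \<phi>')" by (simp add: norm l diff_divide_distrib)
    ultimately have g: "1 - 1 / (r - 1) \<le> 1 - \<phi> - s" by linarith
    have "(1 - 1 / r) * (1 + \<phi> * \<psi>) \<le> 1 + \<psi> - T"
      using parity_values(2)
    proof
      assume m: "m = 0"
      have "1 - 1 / r + \<phi> * \<psi> \<le> 1 + \<phi> * \<psi>" using r3 by simp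
      then show ?thesis using gap_mult_le m0[OF m] by linarith
    next
      assume m: "m = 1"
      have "\<psi> * (\<phi> + T') \<le> \<psi> * 1"
        using psi_bounds(1) phi_bounds(3) right(4) t_bounds by (intro mult_left_mono) auto
      then have "\<psi> * \<phi> + \<psi> * T' \<le> 1 / r" using psi_bounds(4)[OF m] by (simp add: algebra_simps)
      then show ?thesis using gap_mult_le m1[OF m] by (simp add: mult.commute)
    qed
    from gap_mult[OF this g] show ?thesis .
  next
    assume l: "l = 1"
    have x: "r \<le> x" using left(1) l by (auto simp: cf_digit_def)
    define C where "C = 1 - 2 * \<theta>^2 - \<theta>^3"
    note C = cube_factor[folded C_def]
    have "r * (- s') \<le> r * (\<phi>' / (r - 1))" using left(4) r3 by (intro mult_left_mono) auto
    also have "\<dots> = (r / (r - 1)) * \<phi>'" by simp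
    also have "\<dots> \<le> 2 * \<phi>'" using left(2) r3 by (intro mult_right_mono) (auto simp: field_simps)
    finally have "r * (2 - s') \<le> 2 * (x + \<phi>')" using x by (simp add: algebra_simps)
    then have "(2 - s') / (x + \<phi>') \<le> 2 / r" using xp r3 by (simp add: field_simps)
    moreover have "\<phi> + s = (2 - s') / (x + \<phi>')" by (simp add: norm l diff_divide_distrib)
    ultimately have g: "1 - 2 / r \<le> 1 - \<phi> - s" by linarith
    have "C * (1 + \<phi> * \<psi>) \<le> 1 + \<psi> - T"
      using parity_values(2)
    proof
      assume m: "m = 0"
      have "C * (1 + \<phi> * \<psi>) \<le> 1 * (1 + \<phi> * \<psi>)"
        using C phi_bounds(1) psi_bounds(1) by (intro mult_right_mono) auto
      also have "\<dots> \<le> 1 + \<psi> - T" using m0[OF m] by simp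
      finally show ?thesis .
    next
      assume m: "m = 1"
      have z: "r \<le> z" using right(1) m by (auto simp: cf_digit_def)
      \<comment> \<open>For the slope \<open>1 - C\<close> the constant term is evaluated by
        \<open>tail_const\<close>; the \<open>C * (1 / r)\<close> that appears absorbs
        \<open>C * \<phi>\<close>.\<close>
      have "T' - t \<le> (1 - C) * (\<psi>' - \<theta>)"
        using C t_bounds right by (intro tail_slope) auto
      also have "\<dots> \<le> (1 - C) * (z + \<psi>' - (r + \<theta>))"
        using z C by (intro mult_left_mono) auto
      also have "\<dots> = (1 - C) * (z + \<psi>') - (1 - C) * (r + \<theta>)" by (rule right_diff_distrib)
      also have "(1 - C) * (r + \<theta>) = t + C * (1 / r)"
        using tail_const by (simp add: C_def)
      finally have "T' + C * (1 / r) \<le> (1 - C) * (z + \<psi>')" by simp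
      moreover have "C * \<phi> \<le> C * (1 / r)" using C phi_bounds(4)[OF l] by (intro mult_left_mono) auto
      ultimately have "T' + C * \<phi> \<le> (1 - C) * (z + \<psi>')" by linarith
      then have "\<psi> * (T' + C * \<phi>) \<le> \<psi> * ((1 - C) * (z + \<psi>'))" using psi_bounds(1) by (intro mult_left_mono) auto
      also have "\<psi> * ((1 - C) * (z + \<psi>')) = 1 - C" using xp by (simp add: norm)
      finally have "C * (1 + \<phi> * \<psi>) \<le> 1 - \<psi> * T'" by (simp add: algebra_simps)
      then show ?thesis using m1[OF m] by simp
    qed
    then have "(1 - 2 / r) * (C * (1 + \<phi> * \<psi>)) \<le> (1 - \<phi> - s) * (1 + \<psi> - T)"
      using g gap_bounds(3) C phi_bounds(1) psi_bounds(1) by (intro mult_mono) auto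
    then show ?thesis by (simp add: c_def C_def mult.assoc)
  qed
qed

end

end

section \<open>Continued fractions and grid coordinates\<close>

lemma cf_trunc_ge:
  assumes "\<And>i. i \<ge> 1 \<Longrightarrow> a i \<ge> 1"
  shows "real_of_int (a 0) \<le> cf_trunc a n"
  using assms
proof (induction n arbitrary: a)
  case (Suc n)
  have "real_of_int (a 1) \<le> cf_trunc (\<lambda>i. a (Suc i)) n"
    using Suc.IH[of "\<lambda>i. a (Suc i)"] Suc.prems by simp
  moreover have "1 \<le> real_of_int (a 1)" using Suc.prems[of 1] by simp
  ultimately show ?case by simp
qed simp

locale irrational_cf =
  fixes \<alpha> :: real and a :: "nat \<Rightarrow> int"
  assumes irrational: "\<alpha> \<notin> \<rat>" and expansion: "regular_cf_expansion a \<alpha>"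
begin

section \<open>Complete quotients and approximation errors\<close>

primrec complete_quotient :: "nat \<Rightarrow> real" where
  "complete_quotient 0 = \<alpha>"
| "complete_quotient (Suc n) = 1 / (complete_quotient n - of_int (a n))"

abbreviation "q i \<equiv> real_of_int (cf_q a i)"
abbreviation "D \<equiv> cf_D a \<alpha>"
abbreviation "lam i \<equiv> real_of_int (parity_corr a i)"
abbreviation "A i \<equiv> real_of_int (a i)"

lemma a_ge_1: "i \<ge> 1 \<Longrightarrow> A i \<ge> 1"
  using expansion by (auto simp: regular_cf_expansion_def)

lemma lam_cases: "lam i = 0 \<or> lam i = 1" "0 \<le> lam i" "lam i \<le> 1"
  by (auto simp: parity_corr_def)

text \<open>The digits are given only through convergence of the truncations, so the tails are
  identified by inverting the recursion of \<open>cf_trunc\<close>. Irrationality is carried along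
  to keep the denominators nonzero.\<close>

lemma complete_quotient_limit:
  "complete_quotient m \<notin> \<rat> \<and> cf_trunc (\<lambda>i. a (i + m)) \<longlonglongrightarrow> complete_quotient m"
proof (induction m)
  case 0
  then show ?case using irrational expansion by (simp add: regular_cf_expansion_def)
next
  case (Suc m)
  let ?x = "complete_quotient m"
  have ne: "?x - A m \<noteq> 0" using Suc.IH by auto
  have "?x - A m \<notin> \<rat>" using Suc.IH by (metis Rats_add Rats_of_int diff_add_cancel)
  then have 1: "complete_quotient (Suc m) \<notin> \<rat>"
    by (metis Rats_inverse complete_quotient.simps(2) inverse_eq_divide inverse_inverse_eq)
  have "(\<lambda>n. 1 / (cf_trunc (\<lambda>i. a (i + m)) (Suc n) - A m)) \<longlonglongrightarrow> 1 / (?x - A m)"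
    using Suc.IH ne by (intro tendsto_intros LIMSEQ_Suc) auto
  then show ?case using 1 by simp
qed

lemma complete_quotient_gt: "A m < complete_quotient m"
proof -
  have "A m \<le> complete_quotient m"
  proof (cases m)
    case 0
    then show ?thesis using expansion by (simp add: regular_cf_expansion_def)
  next
    case (Suc k)
    have "\<forall>n. A m \<le> cf_trunc (\<lambda>i. a (i + m)) n"
      using cf_trunc_ge[of "\<lambda>i. a (i + m)"] a_ge_1 by simp
    then show ?thesis using complete_quotient_limit[of m] by (meson Lim_bounded2)
  qed
  moreover have "A m \<noteq> complete_quotient m" using complete_quotient_limit[of m] by (metis Rats_of_int)
  ultimately show ?thesis by simp
qed

lemma complete_quotient_pos: "1 < complete_quotient (Suc m)"
  using complete_quotient_gt[of "Suc m"] a_ge_1[of "Suc m"] by simp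

text \<open>Sign and ratio are proved together. If x = y c for consecutive signed errors x, y, the
  recurrence gives x - A y = y (c - A), and c - A is the reciprocal of the next complete
  quotient.\<close>

lemma signed_D:
  "(-1)^i * (q i * \<alpha> - of_int (cf_p a i)) > 0 \<and>
   (-1)^Suc i * (q (Suc i) * \<alpha> - of_int (cf_p a (Suc i)))
     = (-1)^i * (q i * \<alpha> - of_int (cf_p a i)) / complete_quotient (Suc (Suc i))"
proof (induction i)
  case 0
  have 1: "complete_quotient (Suc 0) = 1 / (\<alpha> - A 0)" by simp
  have pos: "0 < \<alpha> - A 0" using complete_quotient_gt[of 0] by simp
  have 2: "complete_quotient (Suc (Suc 0)) = 1 / (1 / (\<alpha> - A 0) - A 1)" by simp
  have "1 / (\<alpha> - A 0) - A 1 \<noteq> 0" using complete_quotient_gt[of 1] by simp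
  then show ?case using pos unfolding 2 by (simp add: field_simps)
next
  case (Suc i)
  define x where "x = (-1)^i * (q i * \<alpha> - of_int (cf_p a i))"
  define y where "y = (-1)^Suc i * (q (Suc i) * \<alpha> - of_int (cf_p a (Suc i)))"
  define z where "z = (-1)^Suc (Suc i) * (q (Suc (Suc i)) * \<alpha> - of_int (cf_p a (Suc (Suc i))))"
  define c where "c = complete_quotient (Suc (Suc i))"
  have IH: "x > 0" "y = x / c" using Suc.IH unfolding x_def y_def c_def by blast+
  have c: "c > 1" unfolding c_def by (rule complete_quotient_pos)
  have "y > 0" using IH c by simp
  have "z = x - A (Suc (Suc i)) * y" by (simp add: x_def y_def z_def algebra_simps)
  moreover have "x = y * c" using IH c by simp
  ultimately have "z = y * (c - A (Suc (Suc i)))" by (simp add: algebra_simps)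
  then have "z = y / complete_quotient (Suc (Suc (Suc i)))"
    unfolding complete_quotient.simps(2)[of "Suc (Suc i)"] c_def by simp
  with \<open>y > 0\<close> show ?case by (simp only: y_def z_def)
qed

lemma D_signed: "D i = (-1)^i * (q i * \<alpha> - of_int (cf_p a i))"
proof -
  have "\<bar>(-1)^i * (q i * \<alpha> - of_int (cf_p a i))\<bar> = D i" by (simp add: cf_D_def abs_mult power_abs)
  then show ?thesis using signed_D[of i] by simp
qed

lemma D_pos: "0 < D i" using signed_D[of i] D_signed[of i] by simp

lemma D_rec: "D (Suc (Suc i)) = D i - A (Suc (Suc i)) * D (Suc i)"
  by (simp add: D_signed algebra_simps)

lemma D_0: "D 0 = \<alpha> - A 0" and D_1: "D (Suc 0) = 1 - A 1 * D 0"
  by (simp_all add: D_signed algebra_simps)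

lemma q_pos: "1 \<le> q i"
proof -
  have "1 \<le> cf_q a i"
    using expansion
  proof (induction i rule: induct_nat_012)
    case (ge2 n)
    then have "1 \<le> a (Suc (Suc n))" by (auto simp: regular_cf_expansion_def)
    then have "1 * 1 \<le> a (Suc (Suc n)) * cf_q a (Suc n)" using ge2 by (intro mult_mono) auto
    then show ?case using ge2 by simp
  qed (auto simp: regular_cf_expansion_def)
  then show ?thesis by simp
qed

lemma q_ge: "real i \<le> q i"
proof (induction i rule: induct_nat_012)
  case 1
  then show ?case using q_pos[of 1] by simp
next
  case (ge2 n)
  have "1 * q (Suc n) \<le> A (Suc (Suc n)) * q (Suc n)"
    using a_ge_1 q_pos[of "Suc n"] by (intro mult_right_mono) auto
  then have "real (Suc n) + 1 \<le> A (Suc (Suc n)) * q (Suc n) + q n"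
    using ge2 q_pos[of n] by linarith
  then show ?case by simp
qed simp

text \<open>This is the determinant identity of two consecutive convergents, with the alternating
  signs absorbed into \<open>D\<close>.\<close>

lemma q_D_eq_1: "q (Suc i) * D i + q i * D (Suc i) = 1"
proof (induction i)
  case 0
  then show ?case by (simp add: D_1)
next
  case (Suc i)
  then show ?case by (simp add: D_rec algebra_simps)
qed

lemma D_le: "D i \<le> 1 / real (Suc i)"
proof -
  have "q (Suc i) * D i \<le> 1"
    using q_D_eq_1[of i] mult_nonneg_nonneg[of "q i" "D (Suc i)"] q_pos[of i] D_pos[of "Suc i"] by linarith
  moreover have "real (Suc i) * D i \<le> q (Suc i) * D i"
    using q_ge[of "Suc i"] D_pos[of i] by (intro mult_right_mono) auto
  ultimately have "real (Suc i) * D i \<le> 1" by linarith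
  then show ?thesis by (simp add: field_simps)
qed

lemma D_tendsto_0: "D \<longlonglongrightarrow> 0"
proof (rule tendsto_sandwich[OF _ _ tendsto_const LIMSEQ_inverse_real_of_nat])
  show "\<forall>\<^sub>F n in sequentially. 0 \<le> D n" using D_pos by (simp add: less_imp_le)
  show "\<forall>\<^sub>F n in sequentially. D n \<le> inverse (real (Suc n))"
    using D_le by (simp add: inverse_eq_divide)
qed

lemma A_D_sums: "(\<lambda>j. A (Suc j) * D j) sums (1 + D 0)"
proof -
  \<comment> \<open>\<open>d\<close> is \<open>D\<close> shifted by one, its value 1 at 0 standing
    for the error of the convergent with index -1. The differences then skip one index, so
    neighbours are added before telescoping.\<close>
  define d where "d j = (case j of 0 \<Rightarrow> 1 | Suc i \<Rightarrow> D i)" for j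
  have d: "d \<longlonglongrightarrow> 0"
    using D_tendsto_0 by (subst filterlim_sequentially_Suc[symmetric]) (simp add: d_def)
  have "A (Suc j) * D j = d j - d (Suc (Suc j))" for j
    by (cases j) (simp_all add: d_def D_1 D_rec)
  then have "A (Suc j) * D j = (- d (Suc j) - d (Suc (Suc j))) - (- d j - d (Suc j))" for j
    by simp
  moreover have "(\<lambda>j. (- d (Suc j) - d (Suc (Suc j))) - (- d j - d (Suc j))) sums
      (0 - (- d 0 - d (Suc 0)))"
  proof (rule telescope_sums)
    have "(\<lambda>j. - d j - d (Suc j)) \<longlonglongrightarrow> - 0 - 0"
      by (intro tendsto_intros d LIMSEQ_Suc)
    then show "(\<lambda>j. - d j - d (Suc j)) \<longlonglongrightarrow> 0" by simp
  qed
  ultimately show ?thesis by (simp add: d_def add.commute)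
qed

section \<open>Parity corrections and coordinates of grid points\<close>

definition tau :: "nat \<Rightarrow> real" where
  "tau k = (\<Sum>j. lam (Suc (j + k)) * D (j + k))"

lemma lam_D_summable: "summable (\<lambda>j. lam (Suc j) * D j)"
proof (rule summable_comparison_test')
  show "summable (\<lambda>j. A (Suc j) * D j)" using A_D_sums by (rule sums_summable)
  show "norm (lam (Suc j) * D j) \<le> A (Suc j) * D j" if "j \<ge> 0" for j
    using lam_cases[of "Suc j"] a_ge_1[of "Suc j"] D_pos[of j]
    by (auto simp: abs_mult intro!: mult_right_mono)
qed

lemma tau_summable: "summable (\<lambda>j. lam (Suc (j + k)) * D (j + k))"
  using summable_ignore_initial_segment[OF lam_D_summable, of k] by simp

lemma tau_rec: "tau k = lam (Suc k) * D k + tau (Suc k)"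
  unfolding tau_def using suminf_split_head[OF tau_summable[of k]] by simp

lemma tau_nonneg: "0 \<le> tau k"
  unfolding tau_def using lam_cases D_pos by (intro suminf_nonneg tau_summable) (simp add: less_imp_le)

lemma gamma_ss_eq: "2 * gamma_ss a \<alpha> = 1 + D 0 + tau 0"
proof -
  have "(\<lambda>j. lam (Suc j) * D j) sums tau 0"
    using tau_summable[of 0] by (simp add: tau_def summable_sums)
  from sums_mult[OF sums_add[OF A_D_sums this], of "1/2"]
  have "(\<lambda>j. 1/2 * of_int (a (Suc j) + parity_corr a (Suc j)) * D j) sums (1/2 * (1 + D 0 + tau 0))"
    by (simp add: algebra_simps)
  then show ?thesis unfolding gamma_ss_def by (simp add: sums_iff)
qed

text \<open>The counterpart of \<open>tau\<close> for the denominators: an alternating sum over the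
  past corrections. The start -1 is the value for which \<open>coord_n\<close> holds at index
  0.\<close>

primrec sigma :: "nat \<Rightarrow> real" where
  "sigma 0 = -1"
| "sigma (Suc k) = lam (Suc k) * q k - sigma k"

context
  fixes n m :: int
begin

text \<open>The coordinates of the grid point belonging to \<open>n\<alpha> - m - \<gamma>\<^sub>*\<^sub>*\<close> with respect to
  consecutive convergents: \<open>coord (k + 1)\<close> is the coefficient of the \<open>k\<close>-th and
  \<open>- coord k\<close> that of the \<open>(k + 1)\<close>-st convergent.\<close>

fun coord :: "nat \<Rightarrow> int" where
  "coord 0 = 2 * n * a 0 - 2 * m - 1"
| "coord (Suc 0) = a 1 * coord 0 + 2 * n - 1 - parity_corr a 1"
| "coord (Suc (Suc k)) = a (Suc (Suc k)) * coord (Suc k) + coord k - parity_corr a (Suc (Suc k))"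

text \<open>A partial quotient and its correction have equal parity, so \<open>coord\<close> changes
  by an even number over two steps. In particular no coordinate vanishes.\<close>

lemma odd_coord: "odd (coord k)"
proof (induction k rule: induct_nat_012)
  case 1
  then show ?case by (auto simp: parity_corr_def)
next
  case (ge2 k)
  then show ?case by (auto simp: parity_corr_def)
qed simp

text \<open>Passing to the next pair of convergents changes the basis but not the point; the
  correction removed from the coordinate reappears in \<open>sigma\<close>, and in
  \<open>coord_form\<close> it is taken out of \<open>tau\<close>.\<close>

lemma coord_n:
  "of_int (coord (Suc k)) * q k - of_int (coord k) * q (Suc k) + sigma (Suc k) = (-1)^k * (2 * of_int n)"
proof (induction k)
  case 0
  then show ?case by (simp add: algebra_simps)
next
  case (Suc k)
  then show ?case by (simp add: algebra_simps)
qed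

lemma coord_form:
  "of_int (coord (Suc k)) * D k + of_int (coord k) * D (Suc k) - tau (Suc k)
     = 2 * (of_int n * \<alpha> - of_int m - gamma_ss a \<alpha>)"
proof (induction k)
  case 0
  have "2 * gamma_ss a \<alpha> = 1 + D 0 + lam 1 * D 0 + tau 1" using gamma_ss_eq tau_rec[of 0] by simp
  moreover have "of_int n * \<alpha> = of_int n * A 0 + of_int n * D 0" by (simp add: D_0 algebra_simps)
  ultimately show ?case by (simp add: D_1 algebra_simps)
next
  case (Suc k)
  then show ?case using tau_rec[of "Suc k"] by (simp add: D_rec algebra_simps)
qed

end

end

section \<open>Cells of the grid\<close>

lemma eventually_Suc_step:
  assumes "\<forall>\<^sub>F k in sequentially. P k" and "\<And>k. K \<le> k \<Longrightarrow> P k \<Longrightarrow> Q (Suc k)"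
  shows "\<forall>\<^sub>F k in sequentially. Q k"
proof -
  from assms(1) have "\<forall>\<^sub>F k in sequentially. Q (Suc k)"
    using eventually_ge_at_top[of K] by eventually_elim (use assms(2) in auto)
  then show ?thesis by (simp add: eventually_sequentially_Suc)
qed

text \<open>The product is quadratic in x with leading coefficient \<open>- p * d\<close>, hence
  concave. The term with \<open>p * d\<close> in the proof is its excess over the chord from 1 to
  M.\<close>

lemma concave_product_ge:
  fixes x M p u v d c :: real
  assumes x: "1 \<le> x" "x \<le> M" and pd: "0 \<le> p" "0 \<le> d"
    and ends: "c \<le> (p + u) * (v - d)" "c \<le> (M * p + u) * (v - M * d)"
  shows "c \<le> (x * p + u) * (v - x * d)"
proof (cases "M = 1")
  case True
  then have "x = 1" using x by simp
  then show ?thesis using ends by simp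
next
  case False
  let ?f = "\<lambda>x. (x * p + u) * (v - x * d)"
  have M: "0 < M - 1" using False x by simp
  have "(M - 1) * c = (M - x) * c + (x - 1) * c" by (simp add: algebra_simps)
  also have "\<dots> \<le> (M - x) * ?f 1 + (x - 1) * ?f M"
    using x ends by (intro add_mono mult_left_mono) auto
  also have "\<dots> \<le> (M - x) * ?f 1 + (x - 1) * ?f M + (M - 1) * (p * d * ((x - 1) * (M - x)))"
    using x pd M by simp
  also have "\<dots> = (M - 1) * ?f x" by (simp add: algebra_simps)
  finally show ?thesis using M by simp
qed

locale cf_cells = irrational_cf \<alpha> a + vertex_bounds r \<theta> t c
  for \<alpha> a r \<theta> t c +
  fixes K :: nat
  assumes digits: "K \<le> i \<Longrightarrow> cf_digit r (real_of_int (a i)) (real_of_int (parity_corr a i))"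
begin

text \<open>The indices are shifted by one so that -1 does not occur. \<open>phi\<close> and
  \<open>ss\<close> depend on past partial quotients, \<open>psi\<close> and \<open>tt\<close> on
  future ones, so their recurrences run in opposite directions.\<close>

definition "phi k = q k / q (Suc k)"
definition "psi k = D (Suc k) / D k"
definition "ss k = sigma (Suc k) / q (Suc k)"
definition "tt k = tau (Suc k) / D k"

lemma q_gt_0: "0 < q k" using q_pos[of k] by linarith

lemma phi_Suc: "phi (Suc k) = 1 / (A (Suc (Suc k)) + phi k)"
proof -
  have "A (Suc (Suc k)) + phi k = q (Suc (Suc k)) / q (Suc k)"
    using q_gt_0[of "Suc k"] by (simp add: phi_def add_divide_distrib)
  then show ?thesis by (simp add: phi_def)
qed

lemma ss_Suc: "ss (Suc k) = phi (Suc k) * (lam (Suc (Suc k)) - ss k)"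
proof -
  have "lam (Suc (Suc k)) - ss k = sigma (Suc (Suc k)) / q (Suc k)"
    using q_gt_0[of "Suc k"] unfolding sigma.simps(2)[of "Suc k"] ss_def by (simp add: diff_divide_distrib)
  then show ?thesis using q_gt_0[of "Suc k"] by (simp add: ss_def phi_def)
qed

lemma psi_eq: "psi k = 1 / (A (Suc (Suc k)) + psi (Suc k))"
proof -
  have "A (Suc (Suc k)) + psi (Suc k) = D k / D (Suc k)"
    using D_pos[of "Suc k"] by (simp add: psi_def D_rec field_simps)
  then show ?thesis by (simp add: psi_def)
qed

lemma tt_eq: "tt k = psi k * (lam (Suc (Suc k)) + tt (Suc k))"
  using D_pos[of "Suc k"] D_pos[of k] by (simp add: tt_def psi_def tau_rec[of "Suc k"] field_simps)

lemma phi_nonneg: "0 \<le> phi k" using q_gt_0[of k] q_gt_0[of "Suc k"] by (simp add: phi_def)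

lemma psi_nonneg: "0 \<le> psi k" using D_pos[of k] D_pos[of "Suc k"] by (simp add: psi_def)

lemma tt_nonneg: "0 \<le> tt k" using tau_nonneg D_pos[of k] by (simp add: tt_def)

lemma digits': "K \<le> k \<Longrightarrow> cf_digit r (A (Suc (Suc k))) (lam (Suc (Suc k)))"
  by (rule digits) simp

lemma phi_le: "K \<le> k \<Longrightarrow> phi (Suc k) \<le> 1 / (r - 1) \<and> phi (Suc k) \<le> 1/2"
  using digit_inverse[OF digits' phi_nonneg] by (simp add: phi_Suc)

text \<open>Bounds for \<open>tt\<close> pass from \<open>Suc k\<close> to \<open>k\<close>, so an
  induction needs a starting point far out. Truncation supplies the empty sum, and the limit
  recovers \<open>tt\<close>.\<close>

definition "partial_tt n k = (\<Sum>j<n. lam (Suc (j + Suc k)) * D (j + Suc k)) / D k"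

lemma partial_tt_Suc: "partial_tt (Suc n) k = psi k * (lam (Suc (Suc k)) + partial_tt n (Suc k))"
  unfolding partial_tt_def psi_def sum.lessThan_Suc_shift
  using D_pos[of "Suc k"] by (simp add: add_divide_distrib distrib_left)

lemma partial_tt_bounds:
  "K \<le> k \<Longrightarrow> 0 \<le> partial_tt n k \<and> partial_tt n k \<le> t \<and> partial_tt n k \<le> psi k * (1 + t)"
proof (induction n arbitrary: k)
  case 0
  then show ?case using t_bounds psi_nonneg[of k] by (simp add: partial_tt_def)
next
  case (Suc n)
  let ?T = "partial_tt n (Suc k)"
  have IH: "0 \<le> ?T" "?T \<le> t" "?T \<le> psi (Suc k) * (1 + t)" using Suc.IH[of "Suc k"] Suc.prems by auto
  have "partial_tt (Suc n) k = (lam (Suc (Suc k)) + ?T) / (A (Suc (Suc k)) + psi (Suc k))"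
    unfolding partial_tt_Suc psi_eq[of k] by simp
  then have "partial_tt (Suc n) k \<le> t"
    using tail_step[OF digits'[OF Suc.prems] psi_nonneg IH] by simp
  moreover have "psi k * (lam (Suc (Suc k)) + ?T) \<le> psi k * (1 + t)"
    using lam_cases[of "Suc (Suc k)"] IH psi_nonneg[of k] by (intro mult_left_mono) auto
  moreover have "0 \<le> psi k * (lam (Suc (Suc k)) + ?T)"
    using lam_cases(2)[of "Suc (Suc k)"] IH psi_nonneg[of k] by simp
  ultimately show ?case by (simp add: partial_tt_Suc)
qed

lemma tt_bounds:
  assumes "K \<le> k"
  shows "tt k \<le> t" "tt k \<le> psi k * (1 + t)"
proof -
  have "(\<lambda>n. partial_tt n k) \<longlonglongrightarrow> tt k"
    unfolding partial_tt_def tt_def tau_def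
    using tau_summable[of "Suc k"] D_pos[of k]
    by (intro tendsto_divide summable_LIMSEQ tendsto_const) auto
  then show "tt k \<le> t" "tt k \<le> psi k * (1 + t)"
    using partial_tt_bounds[OF assms] by (auto intro: Lim_bounded)
qed

lemma phi_lam_le:
  assumes "K \<le> k"
  shows "phi (Suc k) * lam (Suc (Suc k)) \<le> 1 / r"
  using lam_cases(1)[of "Suc (Suc k)"] r3 digit_inverse(4)[OF digits'[OF assms] phi_nonneg[of k]]
  by (auto simp: phi_Suc)

lemma ss_Suc_ge: "- phi (Suc k) * ss k \<le> ss (Suc k)"
  using phi_nonneg[of "Suc k"] lam_cases(2)[of "Suc (Suc k)"] by (simp add: ss_Suc algebra_simps)

text \<open>The recursion sends a bound b for \<open>\<bar>ss k\<bar>\<close> to 1/3 + b/2, which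
  has fixed point 2/3. The initial value may be large, since the digits before \<open>K\<close> can
  be small.\<close>

lemma ss_abs_le: "\<bar>ss (K + j)\<bar> \<le> 2/3 + \<bar>ss K\<bar> / 2^j"
proof (induction j)
  case (Suc j)
  let ?k = "K + j" let ?l = "lam (Suc (Suc ?k))" let ?p = "phi (Suc ?k)"
  have "\<bar>ss (Suc ?k)\<bar> \<le> ?p * (?l + \<bar>ss ?k\<bar>)"
    unfolding ss_Suc abs_mult using phi_nonneg lam_cases(2)[of "Suc (Suc ?k)"] by (intro mult_mono) auto
  also have "\<dots> = ?p * ?l + ?p * \<bar>ss ?k\<bar>" by (simp add: distrib_left)
  also have "\<dots> \<le> 1/3 + 1/2 * \<bar>ss ?k\<bar>"
  proof (rule add_mono)
    have "1 / r \<le> 1 / 3" using r3 by simp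
    then show "?p * ?l \<le> 1/3" using phi_lam_le[of ?k] by linarith
    show "?p * \<bar>ss ?k\<bar> \<le> 1/2 * \<bar>ss ?k\<bar>" using phi_le[of ?k] by (intro mult_right_mono) auto
  qed
  also have "\<dots> \<le> 2/3 + \<bar>ss K\<bar> / 2 ^ Suc j" using Suc.IH by simp
  finally show ?case by simp
qed simp

lemma ss_eventually_le_1: "\<forall>\<^sub>F k in sequentially. \<bar>ss k\<bar> \<le> 1"
proof -
  have "(\<lambda>j. 2/3 + \<bar>ss K\<bar> / 2^j) \<longlonglongrightarrow> 2/3 + 0"
    by (intro tendsto_intros LIMSEQ_divide_realpow_zero) auto
  then have "\<forall>\<^sub>F j in sequentially. 2/3 + \<bar>ss K\<bar> / 2^j < 1"
    by (rule order_tendstoD) simp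
  then have "\<forall>\<^sub>F j in sequentially. \<bar>ss (j + K)\<bar> \<le> 1"
    by eventually_elim (metis ss_abs_le add.commute less_imp_le order.trans)
  then show ?thesis by (subst (asm) eventually_sequentially_seg)
qed

text \<open>Each bound at one index yields a better one at the next:
  \<open>\<bar>ss k\<bar> \<le> 1\<close> gives the lower bound \<open>- (1 / (r - 1))\<close>, this
  the upper bound \<open>1 / (r - 1)\<close>, this \<open>- phi k / (r - 1)\<close> from below. The
  latter is at least -1/4, whence 5/4 = 1 + 1/4.\<close>

lemma ss_bounds:
  "\<forall>\<^sub>F k in sequentially. - phi k / (r - 1) \<le> ss k \<and> \<bar>ss k\<bar> \<le> 1/2 \<and> ss k \<le> 5/4 * phi k \<and> phi k \<le> 1/2"
proof -
  have half: "1 / (r - 1) \<le> 1/2" and pos: "0 < 1 / (r - 1)" using r3 by (auto simp: field_simps)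
  have phi: "\<forall>\<^sub>F k in sequentially. phi k \<le> 1/2"
    using eventually_Suc_step[of "\<lambda>_. True" K "\<lambda>k. phi k \<le> 1/2"] phi_le by simp
  have 1: "\<forall>\<^sub>F k in sequentially. - (1 / (r - 1)) \<le> ss k"
    using ss_eventually_le_1
  proof (rule eventually_Suc_step)
    fix k assume k: "K \<le> k" "\<bar>ss k\<bar> \<le> 1"
    have "phi (Suc k) * ss k \<le> phi (Suc k) * 1"
      using k(2) phi_nonneg[of "Suc k"] by (intro mult_left_mono) auto
    also have "\<dots> \<le> 1 / (r - 1)" using phi_le[OF k(1)] by simp
    finally show "- (1 / (r - 1)) \<le> ss (Suc k)" using ss_Suc_ge[of k] by simp
  qed
  have 2: "\<forall>\<^sub>F k in sequentially. ss k \<le> 1 / (r - 1)"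
    using 1
  proof (rule eventually_Suc_step)
    fix k assume k: "K \<le> k" and s: "- (1 / (r - 1)) \<le> ss k"
    let ?p = "phi (Suc k)" and ?l = "lam (Suc (Suc k))"
    show "ss (Suc k) \<le> 1 / (r - 1)"
      using lam_cases(1)[of "Suc (Suc k)"]
    proof
      assume l: "?l = 0"
      have "?p * (- ss k) \<le> ?p * 1" using s half phi_nonneg[of "Suc k"] by (intro mult_left_mono) auto
      then show ?thesis using phi_le[OF k] by (simp add: ss_Suc l)
    next
      assume l: "?l = 1"
      then have p: "?p \<le> 1 / r" using phi_lam_le[OF k] by simp
      have "ss (Suc k) \<le> ?p * (1 + 1 / (r - 1))"
        unfolding ss_Suc l using s phi_nonneg[of "Suc k"] by (intro mult_left_mono) auto
      also have "\<dots> \<le> 1 / r * (1 + 1 / (r - 1))" using p pos by (intro mult_right_mono) auto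
      also have "\<dots> = 1 / (r - 1)" using r3 by (simp add: field_simps)
      finally show ?thesis .
    qed
  qed
  have 3: "\<forall>\<^sub>F k in sequentially. - phi k / (r - 1) \<le> ss k"
    using 2
  proof (rule eventually_Suc_step)
    fix k assume s: "ss k \<le> 1 / (r - 1)"
    have "phi (Suc k) * ss k \<le> phi (Suc k) * (1 / (r - 1))"
      using s phi_nonneg[of "Suc k"] by (intro mult_left_mono) auto
    then show "- phi (Suc k) / (r - 1) \<le> ss (Suc k)" using ss_Suc_ge[of k] by simp
  qed
  have 4: "\<forall>\<^sub>F k in sequentially. ss k \<le> 5/4 * phi k"
    using eventually_conj[OF 3 phi]
  proof (rule eventually_Suc_step)
    fix k assume s: "- phi k / (r - 1) \<le> ss k \<and> phi k \<le> 1/2"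
    have "phi k * (1 / (r - 1)) \<le> 1/2 * (1/2)"
      using s half pos phi_nonneg[of k] by (intro mult_mono) auto
    then have "phi k / (r - 1) \<le> 1/4" by simp
    moreover have "- (phi k / (r - 1)) \<le> ss k" using s by simp
    ultimately have "- ss k \<le> 1/4" by linarith
    then have "phi (Suc k) * (lam (Suc (Suc k)) - ss k) \<le> phi (Suc k) * (5/4)"
      using lam_cases(3)[of "Suc (Suc k)"] phi_nonneg[of "Suc k"] by (intro mult_left_mono) auto
    then show "ss (Suc k) \<le> 5/4 * phi (Suc k)" by (simp add: ss_Suc)
  qed
  show ?thesis using 1 2 3 4 phi by eventually_elim (use half in auto)
qed

section \<open>Vertices of all sufficiently late cells\<close>

lemma scale: "q (Suc k) * D k * (1 + phi k * psi k) = 1"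
  using q_D_eq_1[of k] q_gt_0[of "Suc k"] D_pos[of k] by (simp add: phi_def psi_def field_simps)

lemma vertices_normalized:
  "\<forall>\<^sub>F k in sequentially.
     c * (1 + phi k * psi k) \<le> (1 + phi k + ss k) * (1 - psi k - tt k) \<and>
     c * (1 + phi k * psi k) \<le> (1 + phi k - ss k) * (1 - psi k + tt k) \<and>
     c * (1 + phi k * psi k) \<le> (1 - phi k + ss k) * (1 + psi k + tt k) \<and>
     c * (1 + phi k * psi k) \<le> (1 - phi k - ss k) * (1 + psi k - tt k)"
  using ss_bounds
proof (rule eventually_Suc_step)
  fix k
  assume k: "K \<le> k"
    and "- phi k / (r - 1) \<le> ss k \<and> \<bar>ss k\<bar> \<le> 1/2 \<and> ss k \<le> 5/4 * phi k \<and> phi k \<le> 1/2"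
  then have s: "- phi k / (r - 1) \<le> ss k" "ss k \<le> 1/2" "ss k \<le> 5/4 * phi k" "phi k \<le> 1/2" by auto
  have k': "K \<le> Suc k" "K \<le> Suc (Suc k)" using k by auto
  \<comment> \<open>The left data have index k and the right data k + 2, so both recurrences arrive
    at \<open>Suc k\<close>.\<close>
  note hyps = digits'[OF k] phi_nonneg[of k] s(4,1,2,3) digits'[OF k'(1)] psi_nonneg[of "Suc (Suc k)"]
    tt_nonneg[of "Suc (Suc k)"] tt_bounds[OF k'(2)] phi_Suc[of k] ss_Suc[of k] psi_eq[of "Suc k"]
    tt_eq[of "Suc k"]
  show "c * (1 + phi (Suc k) * psi (Suc k)) \<le> (1 + phi (Suc k) + ss (Suc k)) * (1 - psi (Suc k) - tt (Suc k)) \<and>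
     c * (1 + phi (Suc k) * psi (Suc k)) \<le> (1 + phi (Suc k) - ss (Suc k)) * (1 - psi (Suc k) + tt (Suc k)) \<and>
     c * (1 + phi (Suc k) * psi (Suc k)) \<le> (1 - phi (Suc k) + ss (Suc k)) * (1 + psi (Suc k) + tt (Suc k)) \<and>
     c * (1 + phi (Suc k) * psi (Suc k)) \<le> (1 - phi (Suc k) - ss (Suc k)) * (1 + psi (Suc k) - tt (Suc k))"
    using vertex_plus_minus[OF hyps] vertex_plus_minus'[OF hyps]
      vertex_minus_plus[OF hyps] vertex_minus_plus'[OF hyps] by blast
qed

text \<open>The sign \<delta> covers a vertex and its opposite: the first product has
  \<open>coord (Suc k) = \<delta>\<close> and \<open>coord k = -\<delta>\<close>, the second has
  both equal to \<delta>. The last two bounds fix the sign of the first factors, so that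
  \<open>c > 0\<close> makes the second factors positive.\<close>

lemma vertices:
  "\<forall>\<^sub>F k in sequentially. \<forall>\<delta>\<in>{1, -1}.
     c \<le> (q (Suc k) + q k + \<delta> * sigma (Suc k)) * (D k - D (Suc k) - \<delta> * tau (Suc k)) \<and>
     c \<le> (q (Suc k) - q k - \<delta> * sigma (Suc k)) * (D k + D (Suc k) - \<delta> * tau (Suc k)) \<and>
     q k \<le> q (Suc k) + q k + \<delta> * sigma (Suc k) \<and>
     0 \<le> q (Suc k) - q k - \<delta> * sigma (Suc k)"
  using vertices_normalized ss_bounds
proof eventually_elim
  case (elim k)
  have Q: "0 < q (Suc k)" and Dk: "0 < D k" using q_gt_0 D_pos by auto
  have eqs: "q k = q (Suc k) * phi k" "sigma (Suc k) = q (Suc k) * ss k"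
     "D (Suc k) = D k * psi k" "tau (Suc k) = D k * tt k"
    using Q Dk by (simp_all add: phi_def ss_def psi_def tt_def)
  have rescale: "c \<le> (q (Suc k) * u) * (D k * v)" if "c * (1 + phi k * psi k) \<le> u * v" for u v
  proof -
    have "c = q (Suc k) * D k * (c * (1 + phi k * psi k))" using scale[of k] by (simp add: ac_simps)
    also have "\<dots> \<le> q (Suc k) * D k * (u * v)" using that Q Dk by (intro mult_left_mono) auto
    finally show ?thesis by (simp add: ac_simps)
  qed
  have s: "0 \<le> q (Suc k) * (1 + ss k)" "0 \<le> q (Suc k) * (1 - ss k)"
    "0 \<le> q (Suc k) * (1 - phi k + ss k)" "0 \<le> q (Suc k) * (1 - phi k - ss k)"
    using elim(2) Q by (auto intro!: mult_nonneg_nonneg simp del: of_int_0_le_iff)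
  have v: "c \<le> (q (Suc k) * (1 + phi k + ss k)) * (D k * (1 - psi k - tt k))"
    "c \<le> (q (Suc k) * (1 + phi k - ss k)) * (D k * (1 - psi k + tt k))"
    "c \<le> (q (Suc k) * (1 - phi k + ss k)) * (D k * (1 + psi k + tt k))"
    "c \<le> (q (Suc k) * (1 - phi k - ss k)) * (D k * (1 + psi k - tt k))"
    using elim(1) by (auto intro!: rescale)
  show ?case using s v unfolding eqs by (simp add: distrib_left right_diff_distrib del: of_int_0_le_iff)
qed

section \<open>Reduction of an arbitrary grid point to a vertex\<close>

lemma grid_point_bound:
  "\<exists>N. \<forall>n m :: int. N \<le> \<bar>n\<bar> \<longrightarrow> c / 4 \<le> of_int \<bar>n\<bar> * \<bar>of_int n * \<alpha> - of_int m - gamma_ss a \<alpha>\<bar>"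
proof -
  obtain k\<^sub>0 where "\<forall>k\<ge>k\<^sub>0. \<forall>\<delta>\<in>{1, -1}.
     c \<le> (q (Suc k) + q k + \<delta> * sigma (Suc k)) * (D k - D (Suc k) - \<delta> * tau (Suc k)) \<and>
     c \<le> (q (Suc k) - q k - \<delta> * sigma (Suc k)) * (D k + D (Suc k) - \<delta> * tau (Suc k)) \<and>
     q k \<le> q (Suc k) + q k + \<delta> * sigma (Suc k) \<and>
     0 \<le> q (Suc k) - q k - \<delta> * sigma (Suc k)"
    using vertices unfolding eventually_sequentially by blast
  then have W1: "\<And>k \<delta>. k\<^sub>0 \<le> k \<Longrightarrow> \<delta> \<in> {1, -1} \<Longrightarrow>
       c \<le> (q (Suc k) + q k + \<delta> * sigma (Suc k)) * (D k - D (Suc k) - \<delta> * tau (Suc k))"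
    and W2: "\<And>k \<delta>. k\<^sub>0 \<le> k \<Longrightarrow> \<delta> \<in> {1, -1} \<Longrightarrow>
       c \<le> (q (Suc k) - q k - \<delta> * sigma (Suc k)) * (D k + D (Suc k) - \<delta> * tau (Suc k))"
    and P1: "\<And>k \<delta>. k\<^sub>0 \<le> k \<Longrightarrow> \<delta> \<in> {1, -1} \<Longrightarrow> q k \<le> q (Suc k) + q k + \<delta> * sigma (Suc k)"
    and P2: "\<And>k \<delta>. k\<^sub>0 \<le> k \<Longrightarrow> \<delta> \<in> {1, -1} \<Longrightarrow> 0 \<le> q (Suc k) - q k - \<delta> * sigma (Suc k)"
    by blast+
  \<comment> \<open>This is the value of \<open>Y\<close> when both coordinates at
    \<open>k\<^sub>0\<close> are 1. It bounds \<open>\<bar>Y\<bar>\<close> from below whenever they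
    have equal signs, and it does not depend on n.\<close>
  define y\<^sub>0 where "y\<^sub>0 = D k\<^sub>0 + D (Suc k\<^sub>0) - tau (Suc k\<^sub>0)"
  have "0 < (q (Suc k\<^sub>0) - q k\<^sub>0 - sigma (Suc k\<^sub>0)) * y\<^sub>0"
    using W2[of k\<^sub>0 1] c_pos by (simp add: y\<^sub>0_def)
  then have y\<^sub>0: "0 < y\<^sub>0" using P2[of k\<^sub>0 1] by (simp add: zero_less_mult_iff)
  show ?thesis
  proof (intro exI[of _ "\<lceil>c / y\<^sub>0\<rceil>"] allI impI)
    fix n m :: int
    assume n: "\<lceil>c / y\<^sub>0\<rceil> \<le> \<bar>n\<bar>"
    define C where "C k = real_of_int (coord n m k)" for k
    define Y where "Y = 2 * (of_int n * \<alpha> - of_int m - gamma_ss a \<alpha>)"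
    have C_rec: "C (Suc (Suc k)) = A (Suc (Suc k)) * C (Suc k) + C k - lam (Suc (Suc k))" for k
      by (simp add: C_def)
    have Cn: "\<bar>C (Suc k) * q k - C k * q (Suc k) + sigma (Suc k)\<bar> = 2 * \<bar>of_int n\<bar>" for k
      using coord_n[of n m k] by (simp add: C_def abs_mult power_abs)
    have CY: "C (Suc k) * D k + C k * D (Suc k) - tau (Suc k) = Y" for k
      using coord_form[of n m k] by (simp add: C_def Y_def)
    have C_ne: "1 \<le> C k \<or> C k \<le> -1" for k
    proof -
      have "coord n m k \<noteq> 0" using odd_coord[of n m k] by auto
      then have "1 \<le> coord n m k \<or> coord n m k \<le> -1" by linarith
      then show ?thesis unfolding C_def by linarith
    qed
    have goal: "c \<le> (2 * \<bar>of_int n\<bar>) * \<bar>Y\<bar>"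
    proof (cases "0 < C k\<^sub>0 * C (Suc k\<^sub>0)")
      case True
      have "y\<^sub>0 \<le> \<bar>Y\<bar>"
      proof -
        have tau: "0 \<le> tau (Suc k\<^sub>0)" by (rule tau_nonneg)
        have Dp: "0 < D k\<^sub>0" "0 < D (Suc k\<^sub>0)" by (rule D_pos)+
        from True consider "1 \<le> C k\<^sub>0" "1 \<le> C (Suc k\<^sub>0)" | "C k\<^sub>0 \<le> -1" "C (Suc k\<^sub>0) \<le> -1"
          using C_ne[of k\<^sub>0] C_ne[of "Suc k\<^sub>0"] by (auto simp: zero_less_mult_iff)
        then show ?thesis
        proof cases
          case 1
          have "1 * D k\<^sub>0 \<le> C (Suc k\<^sub>0) * D k\<^sub>0" "1 * D (Suc k\<^sub>0) \<le> C k\<^sub>0 * D (Suc k\<^sub>0)"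
            using 1 Dp by (intro mult_right_mono; simp)+
          then show ?thesis using CY[of k\<^sub>0] unfolding y\<^sub>0_def by linarith
        next
          case 2
          have "C (Suc k\<^sub>0) * D k\<^sub>0 \<le> -1 * D k\<^sub>0" "C k\<^sub>0 * D (Suc k\<^sub>0) \<le> -1 * D (Suc k\<^sub>0)"
            using 2 Dp by (intro mult_right_mono; simp)+
          then show ?thesis using CY[of k\<^sub>0] tau unfolding y\<^sub>0_def by linarith
        qed
      qed
      moreover have "c / y\<^sub>0 \<le> \<bar>of_int n\<bar>" using n by (metis ceiling_le_iff of_int_abs)
      ultimately have "(c / y\<^sub>0) * y\<^sub>0 \<le> \<bar>of_int n\<bar> * \<bar>Y\<bar>"
        using y\<^sub>0 c_pos by (intro mult_mono) auto
      then have "c \<le> \<bar>of_int n\<bar> * \<bar>Y\<bar>" using y\<^sub>0 by simp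
      also have "\<dots> \<le> (2 * \<bar>of_int n\<bar>) * \<bar>Y\<bar>" by (intro mult_right_mono) auto
      finally show ?thesis .
    next
      case False
      \<comment> \<open>If the signs stayed opposite forever, the two main terms in
        \<open>Cn\<close> would reinforce each other and \<open>2 * \<bar>n\<bar>\<close> would
        exceed every \<open>q k\<close>.\<close>
      have "\<exists>k\<ge>k\<^sub>0. C (Suc k) * C k < 0 \<and> 0 < C (Suc (Suc k)) * C (Suc k)"
      proof (rule ccontr)
        assume no: "\<not> ?thesis"
        have neg: "C (Suc (k\<^sub>0 + j)) * C (k\<^sub>0 + j) < 0" for j
        proof (induction j)
          case 0
          have "C k\<^sub>0 \<noteq> 0" "C (Suc k\<^sub>0) \<noteq> 0" using C_ne[of k\<^sub>0] C_ne[of "Suc k\<^sub>0"] by auto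
          then have "C (Suc k\<^sub>0) * C k\<^sub>0 \<noteq> 0" by simp
          moreover have "\<not> 0 < C (Suc k\<^sub>0) * C k\<^sub>0" using False by (subst mult.commute)
          ultimately have "C (Suc k\<^sub>0) * C k\<^sub>0 < 0" by (meson linorder_cases)
          then show ?case by simp
        next
          case (Suc j)
          have "C (Suc (k\<^sub>0 + j)) \<noteq> 0" "C (Suc (Suc (k\<^sub>0 + j))) \<noteq> 0"
            using C_ne[of "Suc (k\<^sub>0 + j)"] C_ne[of "Suc (Suc (k\<^sub>0 + j))"] by auto
          then have "C (Suc (Suc (k\<^sub>0 + j))) * C (Suc (k\<^sub>0 + j)) \<noteq> 0" by simp
          moreover have "\<not> 0 < C (Suc (Suc (k\<^sub>0 + j))) * C (Suc (k\<^sub>0 + j))"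
            using no Suc.IH le_add1 by blast
          ultimately have "C (Suc (Suc (k\<^sub>0 + j))) * C (Suc (k\<^sub>0 + j)) < 0" by (meson linorder_cases)
          then show ?case by simp
        qed
        have "real k \<le> 2 * \<bar>of_int n\<bar>" if k: "k\<^sub>0 \<le> k" for k
        proof -
          have qp: "0 < q k" "0 < q (Suc k)" by (rule q_gt_0)+
          have "C (Suc k) * C k < 0" using neg[of "k - k\<^sub>0"] k by simp
          then consider "C k \<le> -1" "1 \<le> C (Suc k)" | "1 \<le> C k" "C (Suc k) \<le> -1"
            using C_ne[of k] C_ne[of "Suc k"] by (auto simp: mult_less_0_iff)
          then have "q k \<le> \<bar>C (Suc k) * q k - C k * q (Suc k) + sigma (Suc k)\<bar>"
          proof cases
            case 1
            have "1 * q k \<le> C (Suc k) * q k" "C k * q (Suc k) \<le> -1 * q (Suc k)"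
              using 1 qp by (intro mult_right_mono; simp)+
            then show ?thesis using P1[of k 1] k by simp
          next
            case 2
            have "1 * q (Suc k) \<le> C k * q (Suc k)" "C (Suc k) * q k \<le> -1 * q k"
              using 2 qp by (intro mult_right_mono; simp)+
            then show ?thesis using P1[of k "-1"] k by simp
          qed
          then show ?thesis using Cn[of k] q_ge[of k] by linarith
        qed
        from this[of "max k\<^sub>0 (nat \<lceil>2 * \<bar>real_of_int n\<bar>\<rceil> + 1)"] show False by linarith
      qed
      then obtain k where k: "k\<^sub>0 \<le> k" "C (Suc k) * C k < 0" "0 < C (Suc (Suc k)) * C (Suc k)"
        by blast
      define \<delta> where "\<delta> = (if 0 < C (Suc k) then 1 else -1 :: real)"
      define x where "x = - (\<delta> * C k)"
      define b where "b = \<delta> * C (Suc k)"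
      define l where "l = lam (Suc (Suc k))"
      have \<delta>: "\<delta> \<in> {1, -1}" "\<delta> * \<delta> = 1" "\<bar>\<delta>\<bar> = 1" by (auto simp: \<delta>_def)
      have x: "1 \<le> x" and b: "1 \<le> b" and z: "1 \<le> \<delta> * C (Suc (Suc k))"
        using k C_ne[of k] C_ne[of "Suc k"] C_ne[of "Suc (Suc k)"]
        by (auto simp: x_def b_def \<delta>_def mult_less_0_iff zero_less_mult_iff)
      \<comment> \<open>\<open>M\<close> is the largest x for which the coordinate with index k + 2,
        times \<delta>, is still at least 1. At x = 1 and at x = M the point thus lies on the
        boundary of the cell at k and at k + 1, respectively.\<close>
      define M where "M = A (Suc (Suc k)) * b - \<delta> * l - 1"
      have "\<delta> * C (Suc (Suc k)) = A (Suc (Suc k)) * b - x - \<delta> * l"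
        by (simp add: C_rec x_def b_def l_def algebra_simps)
      then have xM: "x \<le> M" using z by (simp add: M_def)
      have Dp: "0 < D k" "0 < D (Suc k)" "0 < D (Suc (Suc k))" by (rule D_pos)+
      have qp: "0 < q k" "0 < q (Suc k)" "0 < q (Suc (Suc k))" by (rule q_gt_0)+
      have "c \<le> (x * q (Suc k) + (b * q k + \<delta> * sigma (Suc k)))
                 * ((b * D k - \<delta> * tau (Suc k)) - x * D (Suc k))"
      proof (rule concave_product_ge[OF x xM])
        have 1: "0 < q (Suc k) + q k + \<delta> * sigma (Suc k)" using P1[OF k(1) \<delta>(1)] qp by linarith
        have "0 < (q (Suc k) + q k + \<delta> * sigma (Suc k)) * (D k - D (Suc k) - \<delta> * tau (Suc k))"
          using W1[OF k(1) \<delta>(1)] c_pos by linarith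
        then have 2: "0 < D k - D (Suc k) - \<delta> * tau (Suc k)" using 1 by (simp add: zero_less_mult_iff)
        \<comment> \<open>Both factors grow with b, so b = 1, a vertex, is the worst case.\<close>
        have "1 * q k \<le> b * q k" "1 * D k \<le> b * D k" using b qp Dp by (intro mult_right_mono; simp)+
        then have "(q (Suc k) + q k + \<delta> * sigma (Suc k)) * (D k - D (Suc k) - \<delta> * tau (Suc k))
          \<le> (q (Suc k) + (b * q k + \<delta> * sigma (Suc k))) * ((b * D k - \<delta> * tau (Suc k)) - D (Suc k))"
          using 1 2 by (intro mult_mono) auto
        then show "c \<le> (q (Suc k) + (b * q k + \<delta> * sigma (Suc k))) * ((b * D k - \<delta> * tau (Suc k)) - D (Suc k))"
          using W1[OF k(1) \<delta>(1)] by linarith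
      next
        have k': "k\<^sub>0 \<le> Suc k" using k by simp
        note w = W2[OF k' \<delta>(1)] and p = P2[OF k' \<delta>(1)]
        \<comment> \<open>In the next pair of convergents the endpoint x = M has coordinates 1 and
          b, up to the sign \<delta>; again b = 1 is the worst case.\<close>
        have e1: "M * q (Suc k) + (b * q k + \<delta> * sigma (Suc k))
            = b * q (Suc (Suc k)) - q (Suc k) - \<delta> * sigma (Suc (Suc k))"
          unfolding M_def sigma.simps(2)[of "Suc k"] l_def by (simp add: algebra_simps)
        have e2: "(b * D k - \<delta> * tau (Suc k)) - M * D (Suc k)
            = D (Suc k) + b * D (Suc (Suc k)) - \<delta> * tau (Suc (Suc k))"
          unfolding M_def tau_rec[of "Suc k"] l_def D_rec[of k] by (simp add: algebra_simps)
        have "0 < (q (Suc (Suc k)) - q (Suc k) - \<delta> * sigma (Suc (Suc k))) *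
            (D (Suc k) + D (Suc (Suc k)) - \<delta> * tau (Suc (Suc k)))"
          using w c_pos by linarith
        then have 2: "0 < D (Suc k) + D (Suc (Suc k)) - \<delta> * tau (Suc (Suc k))"
          using p by (simp add: zero_less_mult_iff)
        have "1 * q (Suc (Suc k)) \<le> b * q (Suc (Suc k))" "1 * D (Suc (Suc k)) \<le> b * D (Suc (Suc k))"
          using b qp Dp by (intro mult_right_mono; simp)+
        then have "(q (Suc (Suc k)) - q (Suc k) - \<delta> * sigma (Suc (Suc k))) *
            (D (Suc k) + D (Suc (Suc k)) - \<delta> * tau (Suc (Suc k)))
          \<le> (b * q (Suc (Suc k)) - q (Suc k) - \<delta> * sigma (Suc (Suc k))) *
            (D (Suc k) + b * D (Suc (Suc k)) - \<delta> * tau (Suc (Suc k)))"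
          using p 2 by (intro mult_mono) auto
        then show "c \<le> (M * q (Suc k) + (b * q k + \<delta> * sigma (Suc k)))
            * ((b * D k - \<delta> * tau (Suc k)) - M * D (Suc k))"
          unfolding e1 e2 using w by linarith
      qed (use qp Dp in auto)
      also have "\<dots> = (\<delta> * (C (Suc k) * q k - C k * q (Suc k) + sigma (Suc k))) * (\<delta> * Y)"
        unfolding CY[of k, symmetric] by (simp add: x_def b_def algebra_simps)
      also have "\<dots> \<le> \<bar>\<delta> * (C (Suc k) * q k - C k * q (Suc k) + sigma (Suc k))\<bar> * \<bar>\<delta> * Y\<bar>"
        unfolding abs_mult[symmetric] by (rule abs_ge_self)
      also have "\<dots> = (2 * \<bar>of_int n\<bar>) * \<bar>Y\<bar>" unfolding abs_mult[of \<delta>] \<delta>(3) Cn by simp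
      finally show ?thesis .
    qed
    then show "c / 4 \<le> of_int \<bar>n\<bar> * \<bar>of_int n * \<alpha> - of_int m - gamma_ss a \<alpha>\<bar>"
      unfolding Y_def abs_mult by simp
  qed
qed

end

section \<open>From grid points to the lower limit\<close>

lemma inhom_const_ge:
  assumes "\<And>n m :: int. N \<le> \<bar>n\<bar> \<Longrightarrow> C \<le> of_int \<bar>n\<bar> * \<bar>of_int n * \<alpha> - of_int m - \<gamma>\<bar>"
  shows "ereal C \<le> inhom_const \<alpha> \<gamma>"
  unfolding inhom_const_def
proof (rule Liminf_bounded)
  have "\<forall>\<^sub>F k :: int in at_top. N \<le> k" by (rule eventually_ge_at_top)
  then have "\<forall>\<^sub>F n :: int in filtercomap abs at_top. N \<le> \<bar>n\<bar>" by (rule eventually_filtercomapI)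
  then show "\<forall>\<^sub>F n :: int in filtercomap abs at_top.
      ereal C \<le> ereal (of_int \<bar>n\<bar> * dist_nearest_int (of_int n * \<alpha> - \<gamma>))"
    by eventually_elim (use assms in \<open>simp add: dist_nearest_int_def algebra_simps\<close>)
qed

theorem theorem5:
  fixes \<alpha> :: real and a :: "nat \<Rightarrow> int" and R :: int
  assumes "\<alpha> \<notin> \<rat>"
    and "regular_cf_expansion a \<alpha>"
    and "liminf (\<lambda>i. ereal (of_int (a i))) = ereal (of_int R)"
    and "2 \<le> R"
  shows "inhom_const \<alpha> (gamma_ss a \<alpha>)
           \<ge> ereal (1/4 * (1 - 2 / of_int (R_star R)) * (1 - 2 * theta1 R ^ 2 - theta1 R ^ 3))
       \<and> 1/4 * (1 - 2 / of_int (R_star R)) * (1 - 2 * theta1 R ^ 2 - theta1 R ^ 3)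
           \<ge> 1/4 * (1 - 2 / of_int (R_star R) - 2 / of_int (R_star R) ^ 2 + 3 / of_int (R_star R) ^ 3)"
proof -
  define r where "r = real_of_int (R_star R)"
  define \<theta> where "\<theta> = theta1 R"
  define c where "c = (1 - 2 / r) * (1 - 2 * \<theta>^2 - \<theta>^3)"
  have "3 \<le> R_star R" using assms(4) by (cases "R = 2") (auto simp: R_star_def)
  then have r: "3 \<le> r" unfolding r_def by linarith
  have th: "\<theta> = (sqrt (r^2 + 4) - r) / 2" by (simp add: \<theta>_def r_def theta1_def)
  have "sqrt (r^2) < sqrt (r^2 + 4)" by (subst real_sqrt_less_iff) simp
  then have th_pos: "0 < \<theta>" using r by (simp add: th)
  have "\<theta> * (r + \<theta>) = ((sqrt (r^2 + 4))^2 - r^2) / 4"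
    unfolding th by (simp add: field_simps power2_eq_square)
  then have th_eq: "\<theta> * (r + \<theta>) = 1" by simp
  \<comment> \<open>Subtracting 1/2 gives a strict inequality that holds eventually; integrality
    turns it back into \<open>R \<le> a i\<close>.\<close>
  have "ereal (of_int R - 1/2) < liminf (\<lambda>i. ereal (of_int (a i)))" using assms(3) by simp
  then have "\<forall>\<^sub>F i in sequentially. ereal (of_int R - 1/2) < ereal (of_int (a i))"
    by (rule less_LiminfD)
  then obtain K where K: "\<And>i. K \<le> i \<Longrightarrow> of_int R - 1/2 < real_of_int (a i)"
    by (auto simp: eventually_sequentially)
  have aR: "R \<le> a i" if "K \<le> i" for i using K[OF that] by linarith
  have digits: "cf_digit r (real_of_int (a i)) (real_of_int (parity_corr a i))" if "K \<le> i" for i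
  proof (cases "odd (a i)")
    case True
    \<comment> \<open>If R is even, an odd digit that is at least R is already at least
      \<open>R + 1\<close>.\<close>
    then have "R_star R \<le> a i" using aR[OF that] by (cases "R = a i") (auto simp: R_star_def)
    then show ?thesis using True by (simp add: cf_digit_def r_def parity_corr_def)
  next
    case False
    have "R_star R - 1 \<le> a i" using aR[OF that] by (auto simp: R_star_def)
    then have "r - 1 \<le> real_of_int (a i)" unfolding r_def by linarith
    then show ?thesis using False by (simp add: cf_digit_def parity_corr_def)
  qed
  interpret cf_cells \<alpha> a r \<theta> "\<theta> / (1 - \<theta>)" c K
    by unfold_locales (use assms r th_pos th_eq digits in \<open>auto simp: c_def\<close>)
  obtain N where "\<And>n m :: int. N \<le> \<bar>n\<bar> \<Longrightarrow>
      c / 4 \<le> of_int \<bar>n\<bar> * \<bar>of_int n * \<alpha> - of_int m - gamma_ss a \<alpha>\<bar>"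
    using grid_point_bound by blast
  then have "ereal (c / 4) \<le> inhom_const \<alpha> (gamma_ss a \<alpha>)" by (rule inhom_const_ge)
  moreover have "1 - 2 / r - 2 / r^2 + 3 / r^3 \<le> c"
    unfolding c_def using vertex_const_le[OF r th_pos th_eq] .
  ultimately show ?thesis by (simp add: c_def r_def \<theta>_def)
qed

end
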